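(* Let $L$ be a Lie algebra (not necessarily finite dimensional) over a field $F$ and let $S(L)$ be the sum of all solvable ideals of $L$. Suppose that one of the following holds: (1) $\mathrm{char}\, F=0$; (2) $\mathrm{char}\, F=p>0$ and $S(L)$ is solvable of derived length $<\log_2 p$. Then $S(L)$ is a characteristic ideal of $L$.
   Context: An ideal $J$ of $L$ is called characteristic if $D(J)\subseteq J$ for every derivation $D\in\mathrm{Der}(L)$, where $\mathrm{Der}(L)$ is the set of all $F$-linear derivations of $L$. The derived series of a Lie algebra $M$ is $M^{(0)}=M$, $M^{(k)}=[M^{(k-1)},M^{(k-1)}]$, where brackets of subspaces denote linear spans. The derived length of a solvable Lie algebra $M$ is the least $k\ge 0$ with $M^{(k)}=0$; in particular it is $0$ if and only if $M=0$. *)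

theory Defs
  imports Complex_Main
begin

locale lie_algebra = vector_space scale
  for scale :: "'k::field \<Rightarrow> 'a::ab_group_add \<Rightarrow> 'a" (infixr \<open>*s\<close> 75) +
  fixes bracket :: "'a \<Rightarrow> 'a \<Rightarrow> 'a" (\<open>(\<open>notation=\<open>mixfix bracket\<close>\<close>\<lbrakk>_, _\<rbrakk>)\<close>)
  assumes linear_bracket_left: "Vector_Spaces.linear scale scale (\<lambda>x. \<lbrakk>x, y\<rbrakk>)"
    and linear_bracket_right: "Vector_Spaces.linear scale scale (\<lambda>y. \<lbrakk>x, y\<rbrakk>)"
    and bracket_self: "\<lbrakk>x, x\<rbrakk> = 0"
    and jacobi: "\<lbrakk>x, \<lbrakk>y, z\<rbrakk>\<rbrakk> + \<lbrakk>y, \<lbrakk>z, x\<rbrakk>\<rbrakk> + \<lbrakk>z, \<lbrakk>x, y\<rbrakk>\<rbrakk> = 0"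
begin

definition lie_ideal :: "'a set \<Rightarrow> bool" where
  "lie_ideal J \<longleftrightarrow> subspace J \<and> (\<forall>x. \<forall>y\<in>J. \<lbrakk>x, y\<rbrakk> \<in> J)"

definition derivation :: "('a \<Rightarrow> 'a) \<Rightarrow> bool" where
  "derivation D \<longleftrightarrow>
    Vector_Spaces.linear scale scale D \<and> (\<forall>x y. D \<lbrakk>x, y\<rbrakk> = \<lbrakk>D x, y\<rbrakk> + \<lbrakk>x, D y\<rbrakk>)"

definition characteristic_ideal :: "'a set \<Rightarrow> bool" where
  "characteristic_ideal J \<longleftrightarrow> lie_ideal J \<and> (\<forall>D. derivation D \<longrightarrow> D ` J \<subseteq> J)"

definition set_bracket :: "'a set \<Rightarrow> 'a set \<Rightarrow> 'a set" where
  "set_bracket A B = span {\<lbrakk>x, y\<rbrakk> | x y. x \<in> A \<and> y \<in> B}"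

primrec derived_series :: "'a set \<Rightarrow> nat \<Rightarrow> 'a set" where
  "derived_series M 0 = M"
| "derived_series M (Suc k) = set_bracket (derived_series M k) (derived_series M k)"

definition solvable :: "'a set \<Rightarrow> bool" where
  "solvable M \<longleftrightarrow> (\<exists>k. derived_series M k = {0})"

text \<open>Only meaningful for solvable \<open>M\<close>; otherwise the value is unspecified.\<close>

definition derived_length :: "'a set \<Rightarrow> nat" where
  "derived_length M = (LEAST k. derived_series M k = {0})"

text \<open>The sum of an arbitrary family of subspaces is the span of their union.\<close>

definition solvable_ideal_sum :: "'a set" where
  "solvable_ideal_sum = span (\<Union>{J. lie_ideal J \<and> solvable J})"

end

end

theory Submission
  imports Defs "HOL-Computational_Algebra.Primes"
begin

text \<open>
  If \<open>I\<close> is an ideal with \<open>I\<^sup>(\<^sup>n\<^sup>) = 0\<close> and \<open>D\<close> is a derivation, then \<open>J = I + D I\<close> is an ideal.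
  In the Leibniz expansion of \<open>D\<^sup>2\<^sup>m \<lbrakk>y, z\<rbrakk>\<close> with \<open>m = 2\<^sup>k\<close> and \<open>y, z \<in> I\<^sup>(\<^sup>k\<^sup>)\<close>, every term except the
  middle one \<open>(2m choose m) \<lbrakk>D\<^sup>m y, D\<^sup>m z\<rbrakk>\<close> lies in \<open>I\<close>. If \<open>(2\<^sup>n)!\<close> is invertible in the field,
  the middle coefficients are invertible up to level \<open>n\<close>, so that induction on \<open>k\<close> gives
  \<open>J\<^sup>(\<^sup>k\<^sup>) \<subseteq> I + D\<^sup>m I\<^sup>(\<^sup>k\<^sup>)\<close>. At \<open>k = n\<close> this says \<open>J\<^sup>(\<^sup>n\<^sup>) \<subseteq> I\<close>, hence \<open>J\<close> is solvable and \<open>D I\<close> is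
  contained in the sum of all solvable ideals.
\<close>

section \<open>Factorials in a field\<close>

text \<open>A positive characteristic is prime, and a prime divides \<open>n!\<close> exactly when
  it is at most \<open>n\<close>. This lets both cases of the theorem be handled through one
  condition on \<open>fact (2 ^ n)\<close>.\<close>

lemma of_nat_fact_nonzero_iff:
  "of_nat (fact n) \<noteq> (0 :: 'k::field) \<longleftrightarrow> CHAR('k) = 0 \<or> n < CHAR('k)"
proof (cases "CHAR('k) = 0")
  case False
  then have "prime CHAR('k)"
    by (intro prime_CHAR_semidom) simp
  then show ?thesis
    using False by (simp add: of_nat_eq_0_iff_char_dvd prime_dvd_fact_iff not_le)
qed (simp add: of_nat_eq_0_iff_char_dvd)

context lie_algebra
begin

section \<open>Brackets, ideals and the Leibniz rule\<close>

lemmas bracket_left_hom = module_hom_linearI[OF linear_bracket_left]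
  and bracket_right_hom = module_hom_linearI[OF linear_bracket_right]

lemmas bracket_simps =
  module_hom.add[OF bracket_left_hom] module_hom.add[OF bracket_right_hom]
  module_hom.scale[OF bracket_left_hom] module_hom.scale[OF bracket_right_hom]

lemma bracket_antisym: "\<lbrakk>x, y\<rbrakk> = - \<lbrakk>y, x\<rbrakk>"
proof -
  have "\<lbrakk>x + y, x + y\<rbrakk> = \<lbrakk>x, y\<rbrakk> + \<lbrakk>y, x\<rbrakk>"
    by (simp add: bracket_simps(1,2) bracket_self[of x] bracket_self[of y])
  then have "\<lbrakk>x, y\<rbrakk> + \<lbrakk>y, x\<rbrakk> = 0"
    using bracket_self[of "x + y"] by simp
  then show ?thesis
    by (simp only: eq_neg_iff_add_eq_0)
qed

lemma lie_ideal_subspace: "lie_ideal I \<Longrightarrow> subspace I"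
  by (simp add: lie_ideal_def)

lemma lie_ideal_bracket_right: "lie_ideal I \<Longrightarrow> y \<in> I \<Longrightarrow> \<lbrakk>x, y\<rbrakk> \<in> I"
  by (simp add: lie_ideal_def)

lemma lie_ideal_bracket_left: "lie_ideal I \<Longrightarrow> x \<in> I \<Longrightarrow> \<lbrakk>x, y\<rbrakk> \<in> I"
  by (metis bracket_antisym lie_ideal_bracket_right lie_ideal_subspace subspace_neg)

lemma derivation_linear: "derivation D \<Longrightarrow> Vector_Spaces.linear scale scale D"
  by (simp add: derivation_def)

lemmas derivation_hom = module_hom_linearI[OF derivation_linear]

lemma derivation_bracket: "derivation D \<Longrightarrow> D \<lbrakk>x, y\<rbrakk> = \<lbrakk>D x, y\<rbrakk> + \<lbrakk>x, D y\<rbrakk>"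
  by (simp add: derivation_def)

lemma derivation_funpow_hom:
  assumes "derivation D"
  shows "module_hom scale scale (D ^^ m)"
proof (induction m)
  case 0
  show ?case by (simp add: id_def module_hom_iff_linear linear_ident)
next
  case (Suc m)
  then show ?case
    unfolding funpow.simps using derivation_hom[OF assms] by (rule module_hom_compose)
qed

text \<open>The Leibniz formula, by induction on \<open>m\<close> as for the binomial
  theorem.\<close>

lemma derivation_funpow_bracket:
  assumes D: "derivation D"
  shows "(D ^^ m) \<lbrakk>x, y\<rbrakk> = (\<Sum>i\<le>m. of_nat (m choose i) *s \<lbrakk>(D ^^ i) x, (D ^^ (m - i)) y\<rbrakk>)"
proof (induction m)
  case 0
  show ?case by simp
next
  case (Suc m)
  let ?B = "\<lambda>i j. \<lbrakk>(D ^^ i) x, (D ^^ j) y\<rbrakk>"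
  have "(D ^^ Suc m) \<lbrakk>x, y\<rbrakk> = D (\<Sum>i\<le>m. of_nat (m choose i) *s ?B i (m - i))"
    by (simp add: Suc)
  also have "\<dots> = (\<Sum>i\<le>m. of_nat (m choose i) *s ?B (Suc i) (m - i))
      + (\<Sum>i\<le>m. of_nat (m choose i) *s ?B i (Suc m - i))"
    by (simp add: module_hom.sum[OF derivation_hom[OF D]] module_hom.scale[OF derivation_hom[OF D]]
        derivation_bracket[OF D] scale_right_distrib sum.distrib Suc_diff_le)
  \<comment> \<open>The added term has coefficient \<open>m choose Suc m\<close>, which is 0; with
    it present, splitting off \<open>i = 0\<close> leaves a sum over the same range as the other
    one.\<close>
  also have "(\<Sum>i\<le>m. of_nat (m choose i) *s ?B i (Suc m - i))
      = (\<Sum>i\<le>Suc m. of_nat (m choose i) *s ?B i (Suc m - i))"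
    by (simp add: binomial_eq_0)
  also have "\<dots> = ?B 0 (Suc m) + (\<Sum>i\<le>m. of_nat (m choose Suc i) *s ?B (Suc i) (m - i))"
    by (subst sum.atMost_Suc_shift) simp
  \<comment> \<open>Pascal's rule merges the two sums.\<close>
  also have "(\<Sum>i\<le>m. of_nat (m choose i) *s ?B (Suc i) (m - i)) + \<dots>
      = ?B 0 (Suc m) + (\<Sum>i\<le>m. of_nat (Suc m choose Suc i) *s ?B (Suc i) (m - i))"
    by (simp add: scale_left_distrib sum.distrib)
  also have "\<dots> = (\<Sum>i\<le>Suc m. of_nat (Suc m choose i) *s ?B i (Suc m - i))"
    by (subst sum.atMost_Suc_shift) simp
  finally show ?case .
qed

section \<open>Derived series under powers of a derivation\<close>

lemma set_bracket_subset:
  assumes "subspace C" "\<And>x y. x \<in> A \<Longrightarrow> y \<in> B \<Longrightarrow> \<lbrakk>x, y\<rbrakk> \<in> C"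
  shows "set_bracket A B \<subseteq> C"
  unfolding set_bracket_def using assms by (intro span_minimal) auto

lemma bracket_in_set_bracket: "x \<in> A \<Longrightarrow> y \<in> B \<Longrightarrow> \<lbrakk>x, y\<rbrakk> \<in> set_bracket A B"
  unfolding set_bracket_def by (intro span_base) auto

lemma set_bracket_mono: "A \<subseteq> A' \<Longrightarrow> B \<subseteq> B' \<Longrightarrow> set_bracket A B \<subseteq> set_bracket A' B'"
  unfolding set_bracket_def by (intro span_mono) auto

lemma subspace_derived_series: "subspace M \<Longrightarrow> subspace (derived_series M k)"
  by (cases k) (auto simp: set_bracket_def)

lemma derived_series_mono: "M \<subseteq> N \<Longrightarrow> derived_series M k \<subseteq> derived_series N k"
  by (induction k) (auto intro: set_bracket_mono[THEN subsetD])

lemma derived_series_add: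
  "derived_series M (j + k) = derived_series (derived_series M k) j"
  by (induction j) auto

text \<open>In each Leibniz term the two exponents add up to \<open>j < 2 * 2 ^ k\<close>, so one of
  them is below \<open>2 ^ k\<close>; by induction that factor lies in \<open>I\<close>, and the
  ideal absorbs the bracket.\<close>

lemma derived_series_funpow:
  assumes I: "lie_ideal I" and D: "derivation D"
  shows "y \<in> derived_series I k \<Longrightarrow> j < 2 ^ k \<Longrightarrow> (D ^^ j) y \<in> I"
proof (induction k arbitrary: y j)
  case 0
  then show ?case by simp
next
  case (Suc k)
  note lin = derivation_funpow_hom[OF D, of j]
  have "set_bracket (derived_series I k) (derived_series I k) \<subseteq> (D ^^ j) -` I"
  proof (rule set_bracket_subset)
    show "subspace ((D ^^ j) -` I)"
      using module_hom.subspace_vimage[OF lin lie_ideal_subspace[OF I]] .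
  next
    fix y z assume yz: "y \<in> derived_series I k" "z \<in> derived_series I k"
    have "\<lbrakk>(D ^^ i) y, (D ^^ (j - i)) z\<rbrakk> \<in> I" for i
    proof (cases "i < 2 ^ k")
      case True
      then show ?thesis
        using Suc.IH yz I lie_ideal_bracket_left by blast
    next
      case False
      then have "j - i < 2 ^ k"
        using Suc.prems(2) by simp
      then show ?thesis
        using Suc.IH yz I lie_ideal_bracket_right by blast
    qed
    then show "\<lbrakk>y, z\<rbrakk> \<in> (D ^^ j) -` I"
      using lie_ideal_subspace[OF I]
      by (auto simp: derivation_funpow_bracket[OF D] intro!: subspace_sum subspace_scale)
  qed
  then show ?case
    using Suc.prems(1) by auto
qed

text \<open>Exponents adding up to \<open>2 * m\<close> and not both equal to \<open>m\<close>
  include one below \<open>m = 2 ^ k\<close>, so \<open>derived_series_funpow\<close> puts every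
  other term in \<open>I\<close>.\<close>

lemma derivation_funpow_bracket_middle:
  assumes I: "lie_ideal I" and D: "derivation D"
    and yz: "y \<in> derived_series I k" "z \<in> derived_series I k"
  defines "m \<equiv> 2 ^ k"
  shows "(D ^^ (2 * m)) \<lbrakk>y, z\<rbrakk> - of_nat (2 * m choose m) *s \<lbrakk>(D ^^ m) y, (D ^^ m) z\<rbrakk> \<in> I"
proof -
  let ?t = "\<lambda>i. of_nat (2 * m choose i) *s \<lbrakk>(D ^^ i) y, (D ^^ (2 * m - i)) z\<rbrakk>"
  have "?t i \<in> I" if "i \<noteq> m" for i
  proof -
    \<comment> \<open>Here \<open>i\<close> is unbounded: for \<open>i > 2 * m\<close> the truncated
      difference is 0, which is below \<open>m\<close> because \<open>m\<close> is positive.\<close>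
    have "0 < m"
      by (simp add: m_def)
    then have "i < m \<or> 2 * m - i < m"
      using that by linarith
    then have "(D ^^ i) y \<in> I \<or> (D ^^ (2 * m - i)) z \<in> I"
      using derived_series_funpow[OF I D] yz by (auto simp: m_def)
    then show ?thesis
      using I lie_ideal_bracket_left lie_ideal_bracket_right
      by (intro subspace_scale lie_ideal_subspace) blast+
  qed
  then have "(\<Sum>i\<in>{..2 * m} - {m}. ?t i) \<in> I"
    using I by (intro subspace_sum lie_ideal_subspace) auto
  moreover have "(D ^^ (2 * m)) \<lbrakk>y, z\<rbrakk> = ?t m + (\<Sum>i\<in>{..2 * m} - {m}. ?t i)"
    unfolding derivation_funpow_bracket[OF D] by (intro sum.remove) auto
  ultimately show ?thesis
    by (simp add: mult_2)
qed

section \<open>The ideal \<open>I + D I\<close> and its solvability\<close>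

text \<open>\<open>A\<close> and \<open>I\<close> are separate arguments because, along the derived
  series, \<open>A\<close> shrinks while the summand \<open>I\<close> stays fixed.\<close>

definition ideal_plus_image :: "('a \<Rightarrow> 'a) \<Rightarrow> 'a set \<Rightarrow> 'a set \<Rightarrow> 'a set" where
  "ideal_plus_image f A I = {a + b | a b. a \<in> I \<and> b \<in> f ` A}"

lemma subspace_ideal_plus_image:
  assumes "module_hom scale scale f" "subspace A" "subspace I"
  shows "subspace (ideal_plus_image f A I)"
  unfolding ideal_plus_image_def
  using subspace_sums[OF assms(3) module_hom.subspace_image[OF assms(1,2)]] .

text \<open>The Leibniz rule turns \<open>[x, D b]\<close> into \<open>D [x, b] - [D x, b]\<close>,
  whose last term is again in \<open>I\<close>.\<close>

lemma lie_ideal_plus_derivation_image: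
  assumes I: "lie_ideal I" and D: "derivation D"
  shows "lie_ideal (ideal_plus_image D I I)"
  unfolding lie_ideal_def
proof (intro conjI allI ballI)
  show "subspace (ideal_plus_image D I I)"
    using subspace_ideal_plus_image derivation_hom[OF D] lie_ideal_subspace[OF I] by blast
next
  fix x w assume "w \<in> ideal_plus_image D I I"
  then obtain a b where ab: "a \<in> I" "b \<in> I" "w = a + D b"
    by (auto simp: ideal_plus_image_def)
  have "\<lbrakk>x, w\<rbrakk> = (\<lbrakk>x, a\<rbrakk> - \<lbrakk>D x, b\<rbrakk>) + D \<lbrakk>x, b\<rbrakk>"
    by (simp add: ab derivation_bracket[OF D] bracket_simps)
  moreover have "\<lbrakk>x, a\<rbrakk> - \<lbrakk>D x, b\<rbrakk> \<in> I" "\<lbrakk>x, b\<rbrakk> \<in> I"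
    using ab I by (auto intro!: subspace_diff lie_ideal_subspace lie_ideal_bracket_right)
  ultimately show "\<lbrakk>x, w\<rbrakk> \<in> ideal_plus_image D I I"
    unfolding ideal_plus_image_def by blast
qed

text \<open>Modulo \<open>I\<close>, the bracket of \<open>a + D^m y\<close> and
  \<open>b + D^m z\<close> is \<open>[D^m y, D^m z]\<close>, and this is
  \<open>D^(2m) [y, z]\<close> divided by the middle binomial coefficient.\<close>

lemma derived_series_plus_image:
  assumes I: "lie_ideal I" and D: "derivation D"
  shows "of_nat (fact (2 ^ k)) \<noteq> (0 :: 'k) \<Longrightarrow>
    derived_series (ideal_plus_image D I I) k
      \<subseteq> ideal_plus_image (D ^^ (2 ^ k)) (derived_series I k) I"
proof (induction k)
  case 0
  show ?case by simp
next
  case (Suc k)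
  define m :: nat where "m = 2 ^ k"
  let ?c = "of_nat (2 * m choose m) :: 'k"
  let ?P = "ideal_plus_image (D ^^ (2 * m)) (derived_series I (Suc k)) I"
  have sub: "subspace I"
    using I by (rule lie_ideal_subspace)
  have lin: "module_hom scale scale (D ^^ j)" for j
    using D by (rule derivation_funpow_hom)
  \<comment> \<open>This factorization both passes the hypothesis down to level \<open>k\<close> and
    makes the middle coefficient invertible.\<close>
  have "fact (2 * m) = fact m * fact m * (2 * m choose m)"
    using binomial_fact_lemma[of m "2 * m"] by (simp add: mult_2)
  moreover have "of_nat (fact (2 * m)) \<noteq> (0 :: 'k)"
    using Suc.prems by (simp add: m_def)
  ultimately have fm: "of_nat (fact m) \<noteq> (0 :: 'k)" and c: "?c \<noteq> 0"
    by auto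
  have "set_bracket (derived_series (ideal_plus_image D I I) k)
      (derived_series (ideal_plus_image D I I) k) \<subseteq> ?P"
  proof (rule set_bracket_subset)
    show "subspace ?P"
      using subspace_ideal_plus_image[OF lin subspace_derived_series[OF sub] sub] .
  next
    fix u v
    assume "u \<in> derived_series (ideal_plus_image D I I) k"
      and "v \<in> derived_series (ideal_plus_image D I I) k"
    then have "u \<in> ideal_plus_image (D ^^ m) (derived_series I k) I"
      and "v \<in> ideal_plus_image (D ^^ m) (derived_series I k) I"
      using Suc.IH fm by (auto simp: m_def)
    then obtain a y b z where
      u: "u = a + (D ^^ m) y" "a \<in> I" "y \<in> derived_series I k" and
      v: "v = b + (D ^^ m) z" "b \<in> I" "z \<in> derived_series I k"
      unfolding ideal_plus_image_def by blast
    \<comment> \<open>The scaling makes \<open>D^(2m) w\<close> equal to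
      \<open>[D^m y, D^m z]\<close> up to the error \<open>inverse ?c *s r\<close>, which lies in
      \<open>I\<close>.\<close>
    define w where "w = inverse ?c *s \<lbrakk>y, z\<rbrakk>"
    define r where "r = (D ^^ (2 * m)) \<lbrakk>y, z\<rbrakk> - ?c *s \<lbrakk>(D ^^ m) y, (D ^^ m) z\<rbrakk>"
    have "r \<in> I"
      unfolding r_def m_def by (rule derivation_funpow_bracket_middle[OF I D u(3) v(3)])
    have "w \<in> derived_series I (Suc k)"
      unfolding w_def using subspace_derived_series[OF sub, of "Suc k"]
        bracket_in_set_bracket[OF u(3) v(3)] by (intro subspace_scale) auto
    moreover have "\<lbrakk>u, v\<rbrakk> = (\<lbrakk>a, v\<rbrakk> + \<lbrakk>(D ^^ m) y, b\<rbrakk> - inverse ?c *s r) + (D ^^ (2 * m)) w"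
      using c by (simp add: u(1) v(1) w_def r_def bracket_simps module_hom.scale[OF lin]
          scale_right_diff_distrib)
    moreover have "\<lbrakk>a, v\<rbrakk> + \<lbrakk>(D ^^ m) y, b\<rbrakk> - inverse ?c *s r \<in> I"
      using I sub u(2) v(2) \<open>r \<in> I\<close>
      by (intro subspace_diff subspace_add subspace_scale
          lie_ideal_bracket_left lie_ideal_bracket_right)
    ultimately show "\<lbrakk>u, v\<rbrakk> \<in> ?P"
      unfolding ideal_plus_image_def by blast
  qed
  then show ?case
    by (simp add: m_def)
qed

text \<open>The first \<open>n\<close> derived steps bring \<open>I + D I\<close> into
  \<open>I\<close>, and \<open>n\<close> more annihilate it.\<close>

lemma solvable_ideal_plus_derivation_image:
  assumes I: "lie_ideal I" and D: "derivation D"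
    and n: "derived_series I n = {0}" and fact: "of_nat (fact (2 ^ n)) \<noteq> (0 :: 'k)"
  shows "solvable (ideal_plus_image D I I)"
proof -
  let ?J = "ideal_plus_image D I I"
  \<comment> \<open>As \<open>I^(n)\<close> is zero, so is its image under \<open>D^(2^n)\<close>,
    and only the summand \<open>I\<close> remains in the bound.\<close>
  have "derived_series ?J n \<subseteq> I"
    using derived_series_plus_image[OF I D fact] module_hom.zero[OF derivation_funpow_hom[OF D]]
    by (auto simp: n ideal_plus_image_def)
  then have "derived_series ?J (n + n) \<subseteq> {0}"
    unfolding derived_series_add using derived_series_mono n by metis
  moreover have "0 \<in> derived_series ?J (n + n)"
    using lie_ideal_plus_derivation_image[OF I D]
    by (intro subspace_0 subspace_derived_series lie_ideal_subspace)
  ultimately show ?thesis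
    unfolding solvable_def by blast
qed

section \<open>The sum of all solvable ideals\<close>

lemma derivation_image_subset_solvable_ideal_sum:
  assumes I: "lie_ideal I" and D: "derivation D"
    and n: "derived_series I n = {0}" and fact: "of_nat (fact (2 ^ n)) \<noteq> (0 :: 'k)"
  shows "D ` I \<subseteq> solvable_ideal_sum"
proof -
  have "0 \<in> I"
    using I by (intro subspace_0 lie_ideal_subspace)
  then have "D ` I \<subseteq> ideal_plus_image D I I"
    unfolding ideal_plus_image_def by force
  also have "\<dots> \<subseteq> solvable_ideal_sum"
    using lie_ideal_plus_derivation_image[OF I D] solvable_ideal_plus_derivation_image[OF assms]
    unfolding solvable_ideal_sum_def by (auto intro!: span_base)
  finally show ?thesis .
qed

text \<open>The preimage of the sum under bracketing with \<open>x\<close> is a subspace that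
  contains each solvable ideal, hence their span.\<close>

lemma lie_ideal_solvable_ideal_sum: "lie_ideal solvable_ideal_sum"
  unfolding lie_ideal_def
proof (intro conjI allI ballI)
  show sub: "subspace solvable_ideal_sum"
    by (simp add: solvable_ideal_sum_def)
  fix x y assume "y \<in> solvable_ideal_sum"
  moreover have "solvable_ideal_sum \<subseteq> (\<lambda>y. \<lbrakk>x, y\<rbrakk>) -` solvable_ideal_sum"
    unfolding solvable_ideal_sum_def
    by (intro span_minimal module_hom.subspace_vimage[OF bracket_right_hom])
      (auto intro!: span_base intro: lie_ideal_bracket_right)
  ultimately show "\<lbrakk>x, y\<rbrakk> \<in> solvable_ideal_sum"
    by blast
qed

text \<open>All factorials are invertible, so each solvable ideal can be treated on its own,
  whatever its derived length; linearity of \<open>D\<close> extends the inclusion to the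
  span.\<close>

lemma characteristic_solvable_ideal_sum_CHAR_0:
  assumes "CHAR('k) = 0"
  shows "characteristic_ideal solvable_ideal_sum"
  unfolding characteristic_ideal_def
proof (intro conjI allI impI lie_ideal_solvable_ideal_sum)
  fix D assume D: "derivation D"
  have "J \<subseteq> D -` solvable_ideal_sum" if "lie_ideal J" "solvable J" for J
    using that derivation_image_subset_solvable_ideal_sum[OF _ D] assms
    unfolding solvable_def of_nat_fact_nonzero_iff by blast
  moreover have "subspace (D -` solvable_ideal_sum)"
    using module_hom.subspace_vimage[OF derivation_hom[OF D]]
      lie_ideal_subspace[OF lie_ideal_solvable_ideal_sum] by blast
  ultimately have "solvable_ideal_sum \<subseteq> D -` solvable_ideal_sum"
    by (subst solvable_ideal_sum_def) (intro span_minimal; blast)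
  then show "D ` solvable_ideal_sum \<subseteq> solvable_ideal_sum"
    by blast
qed

text \<open>The sum is itself a solvable ideal here, so the inclusion is applied to it directly,
  with \<open>n\<close> its derived length.\<close>

lemma characteristic_solvable_ideal_sum_CHAR_pos:
  assumes "solvable solvable_ideal_sum" and "2 ^ derived_length solvable_ideal_sum < CHAR('k)"
  shows "characteristic_ideal solvable_ideal_sum"
proof -
  have "derived_series solvable_ideal_sum (derived_length solvable_ideal_sum) = {0}"
    using assms(1) unfolding solvable_def derived_length_def by (rule LeastI_ex)
  then have "D ` solvable_ideal_sum \<subseteq> solvable_ideal_sum" if "derivation D" for D
    using derivation_image_subset_solvable_ideal_sum[OF lie_ideal_solvable_ideal_sum that] assms(2)
    unfolding of_nat_fact_nonzero_iff by blast
  then show ?thesis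
    unfolding characteristic_ideal_def using lie_ideal_solvable_ideal_sum by blast
qed

end

theorem theorem2:
  fixes scale :: "'k::field \<Rightarrow> 'a::ab_group_add \<Rightarrow> 'a"
    and bracket :: "'a \<Rightarrow> 'a \<Rightarrow> 'a"
  assumes "lie_algebra scale bracket"
    and "CHAR('k) = 0 \<or>
      (CHAR('k) > 0 \<and>
       lie_algebra.solvable scale bracket (lie_algebra.solvable_ideal_sum scale bracket) \<and>
       real (lie_algebra.derived_length scale bracket (lie_algebra.solvable_ideal_sum scale bracket))
         < log 2 (real CHAR('k)))"
  shows "lie_algebra.characteristic_ideal scale bracket
    (lie_algebra.solvable_ideal_sum scale bracket)"
proof -
  interpret lie_algebra scale bracket
    by (rule assms(1))
  \<comment> \<open>The logarithmic bound is turned into the inequality of naturals under which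
    \<open>fact (2 ^ n)\<close> is nonzero in the field.\<close>
  have "2 ^ n < CHAR('k)" if "CHAR('k) > 0" "real n < log 2 (real CHAR('k))" for n
  proof -
    have "2 powr real n < real CHAR('k)"
      using that by (simp add: less_log_iff)
    then have "real (2 ^ n) < real CHAR('k)"
      by (simp add: powr_realpow)
    then show ?thesis
      by (simp only: of_nat_less_iff)
  qed
  then show ?thesis
    using assms(2) characteristic_solvable_ideal_sum_CHAR_0
      characteristic_solvable_ideal_sum_CHAR_pos by blast
qed

end
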